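(* Let $\mathring p:\mathbb{Z}^2\to\mathbf{E}^2$ be a conical net, let $o:\mathbb{Z}^2\to\mathbf{E}^2\simeq\mathbb{R}^2$ be an origami map of $\mathring p$, and let $$h:\mathbb{Z}^2\to\mathbb{R}^{2,2},\qquad h(v)=(\mathring p(v),o(v)).$$ Then $h$ is a cyclographic lift of $\mathring p$; that is, there is a Lorentz lift $(c,c_F)$ of $\mathring p$ such that for every $v\in\mathbb{Z}^2$ the cyclographic lift of the oriented sphere $c(v)$ is the point $h(v)$.
   Context: $\mathbb{Z}^2$ is the vertex set of the square lattice graph, $F(\mathbb{Z}^2)$ its set of unit square faces. Conical nets: a circle pattern is a pair of maps $p$ from $\mathbb{Z}^2$ to circles in the Euclidean plane $\mathbf{E}^2$ and $p_F:F(\mathbb{Z}^2)\to\mathbf{E}^2$ with $p_F(f)\in p(v)$ whenever $v,f$ are incident. Nondegeneracy: all radii are positive, centers of adjacent vertices are distinct, and for each edge $(v,v')$ with adjacent faces $f,f'$ the point $p_F(f')$ is the reflection of $p_F(f)$ in the line through the centers of $p(v),p(v')$. A conical net is the map $\mathring p$ of circle centers of a circle pattern. For adjacent faces $f,f'$ with common edge $(v,v')$ let $\rho(f,f')$ be the reflection of $\mathbf{E}^2$ in the line through $\mathring p(v)$ and $\mathring p(v')$. For a conical net the composition of these reflections along any closed cycle of adjacent faces is the identity. Origami map: choose $\mathscr{R}:F(\mathbb{Z}^2)\to\mathrm{Iso}(\mathbf{E}^2)$ with $\mathscr{R}(f')=\mathscr{R}(f)\circ\rho(f,f')$ for all adjacent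 $f,f'$. The origami map is $o(v)=\mathscr{R}(f_v)(\mathring p(v))$, where $f_v$ is any face incident to $v$ (the value does not depend on the choice). Lorentz space $\mathbf{L}^3$ is $\mathbb{R}^3$ with $\langle x,y\rangle=x_1y_1+x_2y_2-x_3y_3$, and $\mathbf{E}^2=\{x_3=0\}$. An oriented timelike sphere has center $m$ and signed radius $r\neq0$, with point set $\{x:\langle x-m,x-m\rangle=r^2\}$ (outward oriented if $r>0$, inward if $r<0$); a null-sphere ($r=0$) is $\{x:\langle x-m,x-m\rangle=0\}$. An isotropic line is $L=\{q+td\}$, $d\neq0$, $\langle d,d\rangle=0$, contained in the unique isotropic plane $H_L=\{x:\langle x-q,d\rangle=0\}$; an orientation of $L$ is a choice of a component $\Omega$ of $H_L\setminus L$. A null-sphere is in contact with $(L,\Omega)$ iff its center lies on $L$; an oriented timelike sphere $(m,r)$ is in contact with $(L,\Omega)$ iff it contains $L$ (forcing $m\in H_L\setminus L$) and $m\notin\Omega$ if $r>0$, $m\in\Omega$ if $r<0$. Lorentz lift of a conical net: choose a face $f_0$ and an arbitrary oriented isotropic line $c_F(f_0)$. For adjacent faces let $\rho^{\mathcal L}(f,f')$ be the reflection of $\mathbf{L}^3$ acting as $\rho(f,f')$ on $(x_1,x_2)$ and fixing $x_3$; propagate by $c_F(f')=\rho^{\mathcal L}(f,f')(c_F(f))$ (acting on lines together with their chosen components) to obtain $c_F$ on all faces. For $v\in\mathbb{Z}^2$, $c(v)$ is the unique oriented timelike sphere or null-sphere whose center lies on the vertical line through $\mathring p(v)$ and which is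 in oriented contact with $c_F(f)$ for the faces $f$ incident to $v$. The pair $(c,c_F)$ is a Lorentz lift of $\mathring p$; it is a contact congruence, i.e. $c(v)$ is in oriented contact with $c_F(f)$ whenever $v,f$ are incident. Cyclographic model: $\mathbb{R}^{2,2}$ is $\mathbb{R}^4$ with the form $x_1y_1+x_2y_2-x_3y_3-x_4y_4$. The cyclographic lift of the oriented sphere with center $m=(m_1,m_2,m_3)$ and signed radius $r$ is the point $(m_1,m_2,m_3,r)$. A cyclographic lift of $\mathring p$ is the map $v\mapsto$ cyclographic lift of $c(v)$ for a Lorentz lift $(c,c_F)$ of $\mathring p$. *)

theory Defs
  imports "HOL-Analysis.Analysis"
begin

section \<open>The square lattice\<close>

type_synonym vertex = "int \<times> int"

text \<open>A unit square of the lattice is represented by its lower left corner.\<close>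

datatype face = Face (corner: vertex)

definition vertices_of :: "face \<Rightarrow> vertex set" where
  "vertices_of f = {fst (corner f), fst (corner f) + 1} \<times> {snd (corner f), snd (corner f) + 1}"

definition adjacent_vertices :: "vertex \<Rightarrow> vertex \<Rightarrow> bool" where
  "adjacent_vertices v w \<longleftrightarrow> \<bar>fst v - fst w\<bar> + \<bar>snd v - snd w\<bar> = 1"

text \<open>\<open>common_edge f f' v w\<close>: the faces \<open>f\<close> and \<open>f'\<close> are adjacent along the edge \<open>(v, w)\<close>.\<close>

definition common_edge :: "face \<Rightarrow> face \<Rightarrow> vertex \<Rightarrow> vertex \<Rightarrow> bool" where
  "common_edge f f' v w \<longleftrightarrow> f \<noteq> f' \<and> adjacent_vertices v w \<and>
     {v, w} \<subseteq> vertices_of f \<and> {v, w} \<subseteq> vertices_of f'"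


section \<open>Circle patterns, conical nets and origami maps\<close>

datatype circle = Circle (centre: "real^2") (radius: real)

definition circle_points :: "circle \<Rightarrow> (real^2) set" where
  "circle_points C = sphere (centre C) (radius C)"

text \<open>For \<open>a \<noteq> b\<close>, the point \<open>a + (((x - a) \<bullet> (b - a)) / ((b - a) \<bullet> (b - a))) *\<^sub>R (b - a)\<close> is the
  orthogonal projection of \<open>x\<close> to the line through \<open>a\<close> and \<open>b\<close>.\<close>

definition reflection :: "real^2 \<Rightarrow> real^2 \<Rightarrow> real^2 \<Rightarrow> real^2" where
  "reflection a b x =
     2 *\<^sub>R (a + (((x - a) \<bullet> (b - a)) / ((b - a) \<bullet> (b - a))) *\<^sub>R (b - a)) - x"

definition circle_pattern :: "(vertex \<Rightarrow> circle) \<Rightarrow> (face \<Rightarrow> real^2) \<Rightarrow> bool" where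
  "circle_pattern P PF \<longleftrightarrow>
     (\<forall>v. radius (P v) > 0) \<and>
     (\<forall>v f. v \<in> vertices_of f \<longrightarrow> PF f \<in> circle_points (P v)) \<and>
     (\<forall>v w. adjacent_vertices v w \<longrightarrow> centre (P v) \<noteq> centre (P w)) \<and>
     (\<forall>f f' v w. common_edge f f' v w \<longrightarrow>
        PF f' = reflection (centre (P v)) (centre (P w)) (PF f))"

definition conical_net :: "(vertex \<Rightarrow> real^2) \<Rightarrow> bool" where
  "conical_net p \<longleftrightarrow> (\<exists>P PF. circle_pattern P PF \<and> p = (\<lambda>v. centre (P v)))"

definition Iso_E2 :: "(real^2 \<Rightarrow> real^2) set" where
  "Iso_E2 = {g. bij g \<and> (\<forall>x y. dist (g x) (g y) = dist x y)}"

text \<open>The value \<open>R f (p v)\<close> is the same for all four faces \<open>f\<close> incident to \<open>v\<close>, so it is enough to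
  require the last condition for one of them.\<close>

definition origami_map :: "(vertex \<Rightarrow> real^2) \<Rightarrow> (vertex \<Rightarrow> real^2) \<Rightarrow> bool" where
  "origami_map p om \<longleftrightarrow> (\<exists>R.
     (\<forall>f. R f \<in> Iso_E2) \<and>
     (\<forall>f f' v w. common_edge f f' v w \<longrightarrow> R f' = R f \<circ> reflection (p v) (p w)) \<and>
     (\<forall>v. \<exists>f. v \<in> vertices_of f \<and> om v = R f (p v)))"


section \<open>Lorentz space: oriented spheres and oriented isotropic lines\<close>

definition lorentz :: "real^3 \<Rightarrow> real^3 \<Rightarrow> real" where
  "lorentz x y = x$1 * y$1 + x$2 * y$2 - x$3 * y$3"

text \<open>An oriented timelike sphere if the signed radius is nonzero, and a null-sphere otherwise.\<close>

datatype osphere = OSphere (center: "real^3") (sradius: real)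

definition sphere_points :: "osphere \<Rightarrow> (real^3) set" where
  "sphere_points S = {x. lorentz (x - center S) (x - center S) = (sradius S)\<^sup>2}"

definition line :: "real^3 \<Rightarrow> real^3 \<Rightarrow> (real^3) set" where
  "line q d = {q + t *\<^sub>R d | t. True}"

text \<open>For isotropic \<open>d\<close>, this is the unique isotropic plane containing \<open>line q d\<close>.\<close>

definition isotropic_plane :: "real^3 \<Rightarrow> real^3 \<Rightarrow> (real^3) set" where
  "isotropic_plane q d = {x. lorentz (x - q) d = 0}"

type_synonym oline = "(real^3) set \<times> (real^3) set"

definition oriented_isotropic_line :: "oline \<Rightarrow> bool" where
  "oriented_isotropic_line l \<longleftrightarrow> (\<exists>q d. d \<noteq> 0 \<and> lorentz d d = 0 \<and> fst l = line q d \<and>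
     snd l \<in> components (isotropic_plane q d - line q d))"

definition oriented_contact :: "osphere \<Rightarrow> oline \<Rightarrow> bool" where
  "oriented_contact S l \<longleftrightarrow>
     (if sradius S = 0 then center S \<in> fst l
      else fst l \<subseteq> sphere_points S \<and>
        (sradius S > 0 \<longrightarrow> center S \<notin> snd l) \<and> (sradius S < 0 \<longrightarrow> center S \<in> snd l))"


section \<open>Lorentz lifts and cyclographic lifts\<close>

definition proj_E2 :: "real^3 \<Rightarrow> real^2" where
  "proj_E2 x = vector [x$1, x$2]"

definition lorentz_reflection :: "real^2 \<Rightarrow> real^2 \<Rightarrow> real^3 \<Rightarrow> real^3" where
  "lorentz_reflection a b x =
     (let y = reflection a b (proj_E2 x) in vector [y$1, y$2, x$3])"

definition lifts_vertex ::
  "(vertex \<Rightarrow> real^2) \<Rightarrow> (face \<Rightarrow> oline) \<Rightarrow> vertex \<Rightarrow> osphere \<Rightarrow> bool" where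
  "lifts_vertex p cF v S \<longleftrightarrow> proj_E2 (center S) = p v \<and>
     (\<forall>f. v \<in> vertices_of f \<longrightarrow> oriented_contact S (cF f))"

definition lorentz_lift ::
  "(vertex \<Rightarrow> real^2) \<Rightarrow> (vertex \<Rightarrow> osphere) \<Rightarrow> (face \<Rightarrow> oline) \<Rightarrow> bool" where
  "lorentz_lift p c cF \<longleftrightarrow>
     (\<forall>f. oriented_isotropic_line (cF f)) \<and>
     (\<forall>f f' v w. common_edge f f' v w \<longrightarrow>
        cF f' = map_prod (image (lorentz_reflection (p v) (p w)))
                         (image (lorentz_reflection (p v) (p w))) (cF f)) \<and>
     (\<forall>v. lifts_vertex p cF v (c v) \<and> (\<forall>S. lifts_vertex p cF v S \<longrightarrow> S = c v))"

definition cyclographic_point :: "osphere \<Rightarrow> real^4" where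
  "cyclographic_point S = vector [center S $ 1, center S $ 2, center S $ 3, sradius S]"

definition cyclographic_lift :: "(vertex \<Rightarrow> real^2) \<Rightarrow> (vertex \<Rightarrow> real^4) \<Rightarrow> bool" where
  "cyclographic_lift p h \<longleftrightarrow>
     (\<exists>c cF. lorentz_lift p c cF \<and> (\<forall>v. h v = cyclographic_point (c v)))"

end

theory Submission
  imports Defs
begin

text \<open>For a face \<open>f\<close>, the graph of the first coordinate of the planar isometry \<open>R f\<close> is an isotropic
  plane, in which the second coordinate of \<open>R f\<close> vanishes exactly along an isotropic line. Orient this
  line by the side on which the second coordinate is negative. A sphere with centre \<open>m\<close> and signed radius \<open>r\<close> is
  then in oriented contact with it if and only if \<open>R f\<close> maps the projection of \<open>m\<close> to \<open>(m\<^sub>3, r)\<close>.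
  So the sphere above \<open>p v\<close> in contact with the lines at \<open>v\<close> is the one with
  \<open>(m\<^sub>3, r) = R f (p v)\<close>, which is the value of the origami map. The rule
  \<open>R f' = R f \<circ> \<rho>(f, f')\<close> turns into the propagation rule of the lines, because reflections are
  involutions.\<close>

definition isometry_oline :: "(real^2 \<Rightarrow> real^2) \<Rightarrow> oline" where
  "isometry_oline g =
     ({x. g (proj_E2 x) = vector [x$3, 0]},
      {x. g (proj_E2 x) $ 1 = x$3 \<and> g (proj_E2 x) $ 2 < 0})"

section \<open>Coordinates and reflections\<close>

lemma proj_E2_nth [simp]: "proj_E2 x $ 1 = x $ 1" "proj_E2 x $ 2 = x $ 2"
  by (simp_all add: proj_E2_def)

lemma vec2_eq_iff: "(x :: real^2) = y \<longleftrightarrow> x$1 = y$1 \<and> x$2 = y$2"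
  by (simp add: vec_eq_iff forall_2)

lemma vec3_eq_iff: "(x :: real^3) = y \<longleftrightarrow> x$1 = y$1 \<and> x$2 = y$2 \<and> x$3 = y$3"
  by (simp add: vec_eq_iff forall_3)

lemma inner_vec2: "(x :: real^2) \<bullet> y = x$1 * y$1 + x$2 * y$2"
  by (simp add: inner_vec_def sum_2)

lemma continuous_on_proj_E2: "continuous_on A proj_E2"
proof -
  have "proj_E2 = (\<lambda>x. \<chi> i. if i = 1 then x$1 else x$2)"
    by (simp add: fun_eq_iff vec2_eq_iff)
  moreover have "continuous_on A (\<lambda>x::real^3. (\<chi> i. if i = (1::2) then x$1 else x$2) :: real^2)"
  proof (rule continuous_on_vec_lambda)
    show "continuous_on A (\<lambda>x::real^3. if i = (1::2) then x$1 else x$2)" for i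
      by (cases "i = 1") (simp_all add: continuous_on_component)
  qed
  ultimately show ?thesis by (simp only:)
qed

lemma reflection_involution [simp]: "reflection a b (reflection a b x) = x"
proof (cases "a = b")
  \<comment> \<open>Here \<open>b - a = 0\<close> removes the projection term, leaving the point
    reflection \<open>2 *\<^sub>R a - x\<close>.\<close>
  case True
  then show ?thesis by (simp add: reflection_def)
next
  case False
  \<comment> \<open>The position of the foot of \<open>x\<close> on the line through
    \<open>a\<close> and \<open>b\<close>; the mirror image has the same foot.\<close>
  define c where "c = ((x - a) \<bullet> (b - a)) / ((b - a) \<bullet> (b - a))"
  have nz: "(b - a) \<bullet> (b - a) \<noteq> 0" using False by simp
  have r: "reflection a b x = 2 *\<^sub>R (a + c *\<^sub>R (b - a)) - x"
    by (simp add: reflection_def c_def)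
  have eq: "reflection a b x - a = 2 *\<^sub>R c *\<^sub>R (b - a) - (x - a)"
    unfolding r by (simp add: algebra_simps scaleR_2)
  have "(reflection a b x - a) \<bullet> (b - a) = 2 * c * ((b - a) \<bullet> (b - a)) - (x - a) \<bullet> (b - a)"
    unfolding eq by (simp add: inner_diff_left)
  also have "\<dots> = c * ((b - a) \<bullet> (b - a))"
    using nz by (simp add: c_def)
  finally have "((reflection a b x - a) \<bullet> (b - a)) / ((b - a) \<bullet> (b - a)) = c"
    using nz by simp
  then have "reflection a b (reflection a b x) = 2 *\<^sub>R (a + c *\<^sub>R (b - a)) - reflection a b x"
    by (simp add: reflection_def[of a b "reflection a b x"])
  then show ?thesis by (simp add: r)
qed

lemma reflection_fixes [simp]: "reflection a b a = a" "reflection a b b = b"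
  by (cases "a = b"; simp add: reflection_def scaleR_2)+

lemma proj_E2_lorentz_reflection [simp]:
  "proj_E2 (lorentz_reflection a b x) = reflection a b (proj_E2 x)"
  by (simp add: lorentz_reflection_def Let_def vec2_eq_iff)

lemma lorentz_reflection_nth_3 [simp]: "lorentz_reflection a b x $ 3 = x $ 3"
  by (simp add: lorentz_reflection_def Let_def)

lemma lorentz_reflection_involution [simp]:
  "lorentz_reflection a b (lorentz_reflection a b x) = x"
  by (simp add: lorentz_reflection_def[of a b "lorentz_reflection a b x"] Let_def vec3_eq_iff)

lemma image_involution_eq_vimage:
  assumes "\<And>x. f (f x) = x"
  shows "f ` A = f -` A"
  using assms by (auto simp: image_iff) metis

text \<open>The image under an involution is the preimage, and the Lorentz reflection acts as
  \<open>reflection a b\<close> after projection while keeping \<open>x$3\<close>. This gives the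
  propagation rule of a Lorentz lift.\<close>

lemma isometry_oline_comp_reflection:
  "isometry_oline (g \<circ> reflection a b) =
     map_prod (image (lorentz_reflection a b)) (image (lorentz_reflection a b)) (isometry_oline g)"
  by (simp add: isometry_oline_def image_involution_eq_vimage vimage_def)

section \<open>Oriented isotropic lines from planar isometries\<close>

lemma Iso_E2_inverse:
  assumes "g \<in> Iso_E2"
  obtains J where "\<forall>z. g (J z) = z" "\<forall>y. J (g y) = y" "\<forall>x y. dist (J x) (J y) = dist x y"
proof
  have bij: "bij g" and dg: "\<And>x y. dist (g x) (g y) = dist x y"
    using assms by (auto simp: Iso_E2_def)
  show "\<forall>z. g (inv g z) = z" "\<forall>y. inv g (g y) = y"
    using bij by (simp_all add: bij_is_surj bij_is_inj surj_f_inv_f)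
  then show "\<forall>x y. dist (inv g x) (inv g y) = dist x y"
    using dg by metis
qed

text \<open>If \<open>B\<close> is the linear part of \<open>J\<close>, the inverse of
  \<open>g\<close>, and \<open>e\<close> the first basis vector, then the first coordinate of
  \<open>g y\<close> is the inner product of \<open>y - J 0\<close> with \<open>B e\<close>. So its
  graph has Lorentz normal \<open>(B e, 1)\<close>, which is isotropic because \<open>B e\<close> is
  a unit vector.\<close>

lemma isometry_isotropic_parametrization:
  assumes "g \<in> Iso_E2"
  obtains q d where "d \<noteq> 0" "lorentz d d = 0"
    "\<forall>x. lorentz (x - q) d = g (proj_E2 x) $ 1 - x $ 3"
    "{x. g (proj_E2 x) = vector [x$3, 0]} = line q d"
proof -
  obtain J where gJ: "\<And>z. g (J z) = z" and Jg: "\<And>y. J (g y) = y"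
    and dJ: "\<And>x y. dist (J x) (J y) = dist x y"
    using Iso_E2_inverse[OF assms] by (metis (no_types, lifting))
  define B where "B = (\<lambda>z. J z - J 0)"
  have B: "orthogonal_transformation B"
    unfolding orthogonal_transformation_isometry
    using dJ by (auto simp: B_def dist_norm)
  have linB: "linear B" using B by (simp add: orthogonal_transformation)
  have innerB: "B x \<bullet> B y = x \<bullet> y" for x y
    using B by (simp add: orthogonal_transformation_def)
  define e :: "real^2" where "e = vector [1, 0]"
  \<comment> \<open>The line lies over the image under \<open>J\<close> of the first axis, with
    height equal to the coordinate along that axis.\<close>
  define q :: "real^3" where "q = vector [J 0 $ 1, J 0 $ 2, 0]"
  define d :: "real^3" where "d = vector [B e $ 1, B e $ 2, 1]"
  have Bte: "B (t *\<^sub>R e) = t *\<^sub>R B e" for t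
    using linB by (rule linear_scale)
  show ?thesis
  proof
    show "d \<noteq> 0" by (simp add: d_def vec3_eq_iff)
    show "lorentz d d = 0"
      using innerB[of e e] by (simp add: lorentz_def d_def e_def inner_vec2)
    show "\<forall>x. lorentz (x - q) d = g (proj_E2 x) $ 1 - x $ 3"
    proof
      fix x
      have "B (g (proj_E2 x)) \<bullet> B e = g (proj_E2 x) $ 1"
        unfolding innerB by (simp add: e_def inner_vec2)
      moreover have "B (g (proj_E2 x)) = proj_E2 x - J 0"
        by (simp add: B_def Jg)
      ultimately have "(proj_E2 x - J 0) \<bullet> B e = g (proj_E2 x) $ 1"
        by simp
      then show "lorentz (x - q) d = g (proj_E2 x) $ 1 - x $ 3"
        by (simp add: lorentz_def q_def d_def inner_vec2)
    qed
    show "{x. g (proj_E2 x) = vector [x$3, 0]} = line q d"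
    proof -
      have "g (proj_E2 x) = vector [x$3, 0] \<longleftrightarrow> x \<in> line q d" for x
      proof -
        have "vector [x$3, 0] = x$3 *\<^sub>R e" by (simp add: e_def vec2_eq_iff)
        then have "g (proj_E2 x) = vector [x$3, 0] \<longleftrightarrow> proj_E2 x = J (x$3 *\<^sub>R e)"
          using gJ Jg by metis
        also have "\<dots> \<longleftrightarrow> proj_E2 x = J 0 + x$3 *\<^sub>R B e"
          unfolding Bte[symmetric] by (simp add: B_def)
        also have "\<dots> \<longleftrightarrow> x = q + x$3 *\<^sub>R d"
          by (simp add: vec2_eq_iff vec3_eq_iff q_def d_def)
        \<comment> \<open>As \<open>q\<close> has height 0 and \<open>d\<close> height 1, the
          parameter of a point is its third coordinate.\<close>
        also have "\<dots> \<longleftrightarrow> x \<in> line q d"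
          by (auto simp: line_def q_def d_def)
        finally show ?thesis .
      qed
      then show ?thesis by blast
    qed
  qed
qed

lemma Iso_E2_continuous:
  assumes "g \<in> Iso_E2"
  shows "continuous_on A g"
  unfolding continuous_on_iff using assms by (auto simp: Iso_E2_def)

lemma isometry_oline_half_plane_connected:
  assumes "g \<in> Iso_E2"
  shows "connected (snd (isometry_oline g))" "snd (isometry_oline g) \<noteq> {}"
proof -
  obtain J where gJ: "\<And>z. g (J z) = z" and Jg: "\<And>y. J (g y) = y"
    and dJ: "\<And>x y. dist (J x) (J y) = dist x y"
    using Iso_E2_inverse[OF assms] by (metis (no_types, lifting))
  have contJ: "continuous_on A J" for A
    using dJ by (auto simp: continuous_on_iff)
  \<comment> \<open>\<open>G\<close> parametrizes the graph of the first coordinate of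
    \<open>g\<close> by the values of \<open>g\<close>; the chosen side is thus the continuous image
    of a convex half-plane.\<close>
  define G :: "real^2 \<Rightarrow> real^3" where
    "G = (\<lambda>z. \<chi> i. if i = 1 then J z $ 1 else if i = 2 then J z $ 2 else z $ 1)"
  define H :: "(real^2) set" where "H = {z. z $ 2 < 0}"
  have G_nth: "proj_E2 (G z) = J z" "G z $ 3 = z $ 1" for z
    by (simp_all add: G_def vec2_eq_iff)
  have "continuous_on H G"
    unfolding G_def
  proof (rule continuous_on_vec_lambda)
    show "continuous_on H (\<lambda>z. if i = (1::3) then J z $ 1 else if i = 2 then J z $ 2 else z $ 1)" for i
      using contJ by (cases "i = 1"; cases "i = 2") (auto intro!: continuous_intros)
  qed
  moreover have "convex H"
  proof -
    have "H = {z. axis 2 1 \<bullet> z < 0}" by (auto simp: H_def inner_axis')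
    then show ?thesis by (simp add: convex_halfspace_lt)
  qed
  moreover have image: "snd (isometry_oline g) = G ` H"
  proof (intro set_eqI iffI)
    fix x assume "x \<in> snd (isometry_oline g)"
    then have "g (proj_E2 x) \<in> H" "g (proj_E2 x) $ 1 = x $ 3"
      by (auto simp: isometry_oline_def H_def)
    moreover from this have "x = G (g (proj_E2 x))"
      by (simp add: vec3_eq_iff G_def Jg)
    ultimately show "x \<in> G ` H" by blast
  next
    fix x assume "x \<in> G ` H"
    then show "x \<in> snd (isometry_oline g)"
      by (auto simp: isometry_oline_def H_def G_nth gJ)
  qed
  ultimately show "connected (snd (isometry_oline g))"
    by (simp add: connected_continuous_image convex_connected)
  have "vector [0, -1] \<in> H" by (simp add: H_def)
  then show "snd (isometry_oline g) \<noteq> {}" using image by blast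
qed

text \<open>Within the isotropic plane, the line is the zero set of the second coordinate
  \<open>k\<close>. The connected side \<open>k < 0\<close> is maximal, since a larger connected set
  off the line would make \<open>k\<close> vanish somewhere by the intermediate value
  property.\<close>

lemma oriented_isotropic_line_isometry_oline:
  assumes "g \<in> Iso_E2"
  shows "oriented_isotropic_line (isometry_oline g)"
proof -
  obtain q d where d: "d \<noteq> 0" "lorentz d d = 0"
    and plane: "\<And>x. lorentz (x - q) d = g (proj_E2 x) $ 1 - x $ 3"
    and ln: "{x. g (proj_E2 x) = vector [x$3, 0]} = line q d"
    using isometry_isotropic_parametrization[OF assms] by (metis (no_types, lifting))
  let ?\<Omega> = "snd (isometry_oline g)"
  define k where "k = (\<lambda>x. g (proj_E2 x) $ 2)"
  have contk: "continuous_on A k" for A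
    unfolding k_def
    by (intro continuous_on_component continuous_on_compose2[OF Iso_E2_continuous[OF assms, of UNIV]]
        continuous_on_proj_E2) auto
  have diff: "isotropic_plane q d - line q d = {x. g (proj_E2 x) $ 1 = x $ 3 \<and> k x \<noteq> 0}"
    by (auto simp: isotropic_plane_def plane ln[symmetric] vec2_eq_iff k_def)
  have \<Omega>: "?\<Omega> = {x. g (proj_E2 x) $ 1 = x $ 3 \<and> k x < 0}"
    by (simp add: isometry_oline_def k_def)
  have "?\<Omega> \<in> components (isotropic_plane q d - line q d)"
    unfolding in_components_maximal
  proof (intro conjI allI impI)
    show "?\<Omega> \<noteq> {}" "connected ?\<Omega>"
      using isometry_oline_half_plane_connected[OF assms] by auto
    show "?\<Omega> \<subseteq> isotropic_plane q d - line q d"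
      by (auto simp: diff \<Omega>)
    fix D assume D: "D \<noteq> {} \<and> ?\<Omega> \<subseteq> D \<and> D \<subseteq> isotropic_plane q d - line q d \<and> connected D"
    obtain x0 where x0: "x0 \<in> D" "k x0 < 0"
      using D \<open>?\<Omega> \<noteq> {}\<close> unfolding \<Omega> by blast
    have conn: "connected (k ` D)"
      using D contk by (simp add: connected_continuous_image)
    have "k x < 0" if "x \<in> D" for x
    proof (rule ccontr)
      assume "\<not> k x < 0"
      then have "0 \<in> k ` D"
        using connectedD_interval[OF conn, of "k x0" "k x" 0] x0 that by auto
      then show False using D diff by auto
    qed
    then show "D = ?\<Omega>"
      using D by (auto simp: diff \<Omega>)
  qed
  moreover have "fst (isometry_oline g) = line q d"
    by (simp add: isometry_oline_def ln)
  ultimately show ?thesis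
    unfolding oriented_isotropic_line_def using d by blast
qed

section \<open>Oriented contact in terms of the isometry\<close>

lemma oriented_contact_isometry_oline_iff:
  assumes "g \<in> Iso_E2"
  shows "oriented_contact S (isometry_oline g) \<longleftrightarrow>
           g (proj_E2 (center S)) = vector [center S $ 3, sradius S]"
proof -
  define m r where "m = center S" and "r = sradius S"
  define z where "z = g (proj_E2 m)"
  obtain q d where "d \<noteq> 0" and d: "lorentz d d = 0"
    and plane: "\<And>x. lorentz (x - q) d = g (proj_E2 x) $ 1 - x $ 3"
    and ln: "{x. g (proj_E2 x) = vector [x$3, 0]} = line q d"
    using isometry_isotropic_parametrization[OF assms] by (metis (no_types, lifting))
  \<comment> \<open>The isometry \<open>g\<close> turns the planar distance from \<open>x\<close> to
    \<open>m\<close> into that from \<open>(x$3, 0)\<close> to \<open>z\<close>.\<close>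
  have norm_sq: "lorentz (x - m) (x - m) = (x $ 3 - z $ 1)\<^sup>2 + (z $ 2)\<^sup>2 - (x $ 3 - m $ 3)\<^sup>2"
    if "x \<in> line q d" for x
  proof -
    have gx: "g (proj_E2 x) = vector [x$3, 0]" using that ln by blast
    have "dist (proj_E2 x) (proj_E2 m) = dist (vector [x$3, 0]) z"
      using assms gx unfolding Iso_E2_def z_def by (metis (mono_tags, lifting) mem_Collect_eq)
    then have "(proj_E2 x - proj_E2 m) \<bullet> (proj_E2 x - proj_E2 m) =
        (vector [x$3, 0] - z) \<bullet> (vector [x$3, 0] - z)"
      by (simp add: dist_norm norm_eq)
    then show ?thesis
      by (simp add: lorentz_def inner_vec2 power2_eq_square)
  qed
  have contains_line: "line q d \<subseteq> sphere_points S \<longleftrightarrow> z $ 1 = m $ 3 \<and> (z $ 2)\<^sup>2 = r\<^sup>2"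
  proof
    assume "line q d \<subseteq> sphere_points S"
    then have sq: "lorentz (q + t *\<^sub>R d - m) (q + t *\<^sub>R d - m) = r\<^sup>2" for t
      by (auto simp: sphere_points_def line_def m_def r_def)
    \<comment> \<open>Both values on the left are \<open>r\<^sup>2\<close> and \<open>d\<close> is
      isotropic, so the mixed term vanishes: \<open>m\<close> lies in the isotropic plane, that is,
      \<open>z $ 1 = m $ 3\<close>.\<close>
    have "lorentz (q + 1 *\<^sub>R d - m) (q + 1 *\<^sub>R d - m) - lorentz (q + 0 *\<^sub>R d - m) (q + 0 *\<^sub>R d - m)
        = lorentz d d - 2 * lorentz (m - q) d"
      by (simp add: lorentz_def algebra_simps)
    then have "z $ 1 = m $ 3"
      using sq[of 1] sq[of 0] d plane[of m] by (simp add: z_def)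
    moreover have "q \<in> line q d"
      unfolding line_def by (rule CollectI, rule exI[of _ 0]) simp
    ultimately show "z $ 1 = m $ 3 \<and> (z $ 2)\<^sup>2 = r\<^sup>2"
      using norm_sq[of q] sq[of 0] by simp
  next
    assume "z $ 1 = m $ 3 \<and> (z $ 2)\<^sup>2 = r\<^sup>2"
    then show "line q d \<subseteq> sphere_points S"
      using norm_sq by (auto simp: sphere_points_def m_def r_def)
  qed
  have contact: "oriented_contact S (isometry_oline g) \<longleftrightarrow>
     (if r = 0 then z = vector [m $ 3, 0]
      else (z $ 1 = m $ 3 \<and> (z $ 2)\<^sup>2 = r\<^sup>2) \<and>
        (r > 0 \<longrightarrow> \<not> (z $ 1 = m $ 3 \<and> z $ 2 < 0)) \<and> (r < 0 \<longrightarrow> z $ 1 = m $ 3 \<and> z $ 2 < 0))"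
    unfolding contains_line[symmetric] ln[symmetric]
    by (simp add: oriented_contact_def isometry_oline_def m_def r_def z_def)
  \<comment> \<open>Containing the line leaves \<open>z $ 2\<close> equal to \<open>r\<close> or
    \<open>- r\<close>; for \<open>r \<noteq> 0\<close> the orientation rules out
    \<open>- r\<close>.\<close>
  have "oriented_contact S (isometry_oline g) \<longleftrightarrow> z $ 1 = m $ 3 \<and> z $ 2 = r"
    unfolding contact by (auto simp: vec2_eq_iff power2_eq_iff)
  then show ?thesis
    by (simp add: vec2_eq_iff z_def m_def r_def)
qed

section \<open>Faces around a vertex and assembly of the lift\<close>

lemma mem_vertices_of_iff:
  "v \<in> vertices_of f \<longleftrightarrow>
     f \<in> {Face v, Face (fst v - 1, snd v), Face (fst v, snd v - 1), Face (fst v - 1, snd v - 1)}"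
  by (cases f; cases v; cases "corner f") (auto simp: vertices_of_def)

text \<open>These adjacencies link the four faces around \<open>(i, j)\<close> into a path, crossing
  only edges that start at \<open>(i, j)\<close>.\<close>

lemma common_edges_at_vertex:
  "common_edge (Face (i, j)) (Face (i - 1, j)) (i, j) (i, j + 1)"
  "common_edge (Face (i, j)) (Face (i, j - 1)) (i, j) (i + 1, j)"
  "common_edge (Face (i - 1, j)) (Face (i - 1, j - 1)) (i, j) (i - 1, j)"
  by (auto simp: common_edge_def adjacent_vertices_def vertices_of_def)

text \<open>Crossing an edge at \<open>v\<close> composes \<open>R\<close> with a reflection that
  fixes \<open>p v\<close>.\<close>

lemma folding_value_independent:
  assumes R: "\<And>f f' v w. common_edge f f' v w \<Longrightarrow> R f' = R f \<circ> reflection (p v) (p w)"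
    and "v \<in> vertices_of f" "v \<in> vertices_of f'"
  shows "R f (p v) = R f' (p v)"
proof -
  obtain i j where v: "v = (i, j)" by (cases v)
  have "R g (p v) = R (Face (i, j)) (p v)" if "v \<in> vertices_of g" for g
    using that R[OF common_edges_at_vertex(1)[of i j]] R[OF common_edges_at_vertex(2)[of i j]]
      R[OF common_edges_at_vertex(3)[of i j]]
    unfolding mem_vertices_of_iff by (auto simp: v)
  then show ?thesis using assms(2,3) by simp
qed

theorem theorem5p5:
  fixes p om :: "vertex \<Rightarrow> real^2" and h :: "vertex \<Rightarrow> real^4"
  assumes "conical_net p"
    and "origami_map p om"
    and "h = (\<lambda>v. vector [p v $ 1, p v $ 2, om v $ 1, om v $ 2])"
  shows "cyclographic_lift p h"
proof -
  obtain R where iso: "\<And>f. R f \<in> Iso_E2"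
    and R: "\<And>f f' v w. common_edge f f' v w \<Longrightarrow> R f' = R f \<circ> reflection (p v) (p w)"
    and ex: "\<And>v. \<exists>f. v \<in> vertices_of f \<and> om v = R f (p v)"
    using assms(2) unfolding origami_map_def by blast
  have om: "R f (p v) = om v" if "v \<in> vertices_of f" for f v
    using ex[of v] folding_value_independent[of R p, OF R _ that] by metis
  define cF where "cF = (\<lambda>f. isometry_oline (R f))"
  define c where "c = (\<lambda>v. OSphere (vector [p v $ 1, p v $ 2, om v $ 1]) (om v $ 2))"
  \<comment> \<open>The equivalence yields existence and uniqueness of the sphere over
    \<open>v\<close> at once. Every incident face imposes the same condition, and \<open>ex\<close>
    supplies at least one such face.\<close>
  have lifts: "lifts_vertex p cF v S \<longleftrightarrow> S = c v" for v S
  proof -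
    have contact: "oriented_contact S (cF f) \<longleftrightarrow> om v = vector [center S $ 3, sradius S]"
      if "v \<in> vertices_of f" "proj_E2 (center S) = p v" for f
      using that om oriented_contact_isometry_oline_iff[OF iso] by (simp add: cF_def)
    have "lifts_vertex p cF v S \<longleftrightarrow>
        proj_E2 (center S) = p v \<and> om v = vector [center S $ 3, sradius S]"
      unfolding lifts_vertex_def using contact ex by blast
    also have "\<dots> \<longleftrightarrow> S = c v"
      by (cases S) (auto simp: c_def vec2_eq_iff vec3_eq_iff)
    finally show ?thesis .
  qed
  have "lorentz_lift p c cF"
    unfolding lorentz_lift_def lifts
    using oriented_isotropic_line_isometry_oline[OF iso] R isometry_oline_comp_reflection
    by (simp add: cF_def)
  moreover have "h v = cyclographic_point (c v)" for v
    by (simp add: assms(3) cyclographic_point_def c_def)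
  ultimately show ?thesis
    unfolding cyclographic_lift_def by blast
qed

end
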